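(* Let $k\geq 2$ and $l\geq 0$ be integers and let $p\in(0,1]$. Let $C(k,l)$ denote the number of labeled connected graphs on $k$ vertices with $k-1+l$ edges. Then $$A_1A_2A_3 = C(k,l)\,p^{k+l-1}(1-p)^{\binom{k}{2}-(k+l-1)},$$ where $A_1=(1-(1-p)^k)^{k-1}$, $A_2=\Pr[\mathrm{TREE}]$, and $A_3=\Pr[\mathrm{Bin}(M^*,p)=l]$.
   Context: Tilted balls-into-bins model with tilt $p$: $k-1$ balls $j=1,\dots,k-1$ are placed independently, ball $j$ into bin $T_j\in\{1,\dots,k\}$, where $\Pr[T_j=i]=\frac{p(1-p)^{i-1}}{1-(1-p)^k}$. Let $Z_i$ be the number of balls in bin $i$; set $Y_0=1$ and $Y_i=Y_{i-1}+Z_i-1$ for $1\le i\le k$ (so $Y_k=0$). $\mathrm{TREE}$ is the event that $Y_t>0$ for all $1\le t\le k-1$. Let $M=\binom{k}{2}-\sum_{j=1}^{k-1}T_j$, and let $M^*$ be the random variable $M$ in the probability space conditioned on $\mathrm{TREE}$. $\mathrm{Bin}(M^*,p)$ denotes a random variable which, given $M^*$, is binomial with $M^*$ trials and success probability $p$. *)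

theory Defs
  imports "HOL-Probability.Probability"
begin

definition connected_graph :: "'a set \<Rightarrow> 'a set set \<Rightarrow> bool" where
  "connected_graph V E \<longleftrightarrow> (\<forall>u\<in>V. \<forall>v\<in>V. (u, v) \<in> {(x, y). {x, y} \<in> E}\<^sup>*)"

definition num_connected_graphs :: "nat \<Rightarrow> nat \<Rightarrow> nat" where
  "num_connected_graphs k l =
     card {E. E \<subseteq> {e. e \<subseteq> {1..k} \<and> card e = 2} \<and> card E = k - 1 + l \<and> connected_graph {1..k} E}"

definition bin_weight :: "nat \<Rightarrow> real \<Rightarrow> nat \<Rightarrow> real" where
  "bin_weight k p i = (if i \<in> {1..k} then p * (1 - p) ^ (i - 1) / (1 - (1 - p) ^ k) else 0)"

definition tilted_bin_pmf :: "nat \<Rightarrow> real \<Rightarrow> nat pmf" where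
  "tilted_bin_pmf k p = embed_pmf (bin_weight k p)"

text \<open>A placement is a function sending ball \<open>j \<in> {1..k-1}\<close> to its bin; the default value \<open>0\<close>
  of the product distribution is only taken at indices that are not balls.\<close>

definition placement_pmf :: "nat \<Rightarrow> real \<Rightarrow> (nat \<Rightarrow> nat) pmf" where
  "placement_pmf k p = Pi_pmf {1..k-1} 0 (\<lambda>_. tilted_bin_pmf k p)"

definition Z :: "nat \<Rightarrow> (nat \<Rightarrow> nat) \<Rightarrow> nat \<Rightarrow> nat" where
  "Z k T i = card {j \<in> {1..k-1}. T j = i}"

primrec Y :: "nat \<Rightarrow> (nat \<Rightarrow> nat) \<Rightarrow> nat \<Rightarrow> int" where
  "Y k T 0 = 1"
| "Y k T (Suc i) = Y k T i + int (Z k T (Suc i)) - 1"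

definition TREE :: "nat \<Rightarrow> (nat \<Rightarrow> nat) set" where
  "TREE k = {T. \<forall>t\<in>{1..k-1}. Y k T t > 0}"

definition M :: "nat \<Rightarrow> (nat \<Rightarrow> nat) \<Rightarrow> int" where
  "M k T = int (k choose 2) - (\<Sum>j=1..k-1. int (T j))"

definition Mstar_pmf :: "nat \<Rightarrow> real \<Rightarrow> int pmf" where
  "Mstar_pmf k p = map_pmf (M k) (cond_pmf (placement_pmf k p) (TREE k))"

text \<open>\<open>M\<close> can be negative off \<open>TREE\<close>, but not on it (lemma \<open>Mstar_nonneg\<close> below), so \<open>nat\<close>
  does not truncate here.\<close>

definition Bin_Mstar_pmf :: "nat \<Rightarrow> real \<Rightarrow> nat pmf" where
  "Bin_Mstar_pmf k p = bind_pmf (Mstar_pmf k p) (\<lambda>m. binomial_pmf (nat m) p)"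

text \<open>Well-definedness of the objects above: the bin weights form a probability distribution,
  \<open>TREE\<close> has positive probability, and \<open>M\<^sup>*\<close> is nonnegative.\<close>

lemma sum_bin_weight:
  assumes "k \<ge> 1" "0 < p" "p \<le> 1"
  shows "(\<Sum>i=1..k. bin_weight k p i) = 1"
proof -
  have lt: "(1 - p) ^ k < 1"
    using assms by (intro power_less_one_iff[THEN iffD2]) auto
  have "(\<Sum>i=1..k. bin_weight k p i) = (\<Sum>i<k. p * (1 - p) ^ i / (1 - (1 - p) ^ k))"
    by (rule sum.reindex_bij_witness[of _ Suc "\<lambda>i. i - 1"]) (auto simp: bin_weight_def)
  also have "\<dots> = p * (\<Sum>i<k. (1 - p) ^ i) / (1 - (1 - p) ^ k)"
    by (simp add: sum_distrib_left sum_divide_distrib)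
  also have "p * (\<Sum>i<k. (1 - p) ^ i) = 1 - (1 - p) ^ k"
    using assms by (subst one_diff_power_eq) auto
  finally show ?thesis using lt by simp
qed

lemma bin_weight_nonneg:
  assumes "0 < p" "p \<le> 1"
  shows "bin_weight k p i \<ge> 0"
  using assms by (auto simp: bin_weight_def intro!: divide_nonneg_nonneg power_le_one)

lemma pmf_tilted_bin_pmf:
  assumes "k \<ge> 1" "0 < p" "p \<le> 1"
  shows "pmf (tilted_bin_pmf k p) i = bin_weight k p i"
  unfolding tilted_bin_pmf_def
proof (rule pmf_embed_pmf)
  show "bin_weight k p i \<ge> 0" for i
    using assms by (intro bin_weight_nonneg) auto
  have "(\<integral>\<^sup>+ i. ennreal (bin_weight k p i) \<partial>count_space UNIV)
      = (\<Sum>i=1..k. ennreal (bin_weight k p i))"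
    by (rule nn_integral_count_space'[of "{1..k}"]) (auto simp: bin_weight_def)
  also have "\<dots> = ennreal (\<Sum>i=1..k. bin_weight k p i)"
    using assms by (intro sum_ennreal bin_weight_nonneg) auto
  finally show "(\<integral>\<^sup>+ i. ennreal (bin_weight k p i) \<partial>count_space UNIV) = 1"
    using sum_bin_weight[OF assms] by simp
qed

lemma set_tilted_bin_pmf:
  assumes "k \<ge> 1" "0 < p" "p \<le> 1"
  shows "set_pmf (tilted_bin_pmf k p) \<subseteq> {1..k}" "1 \<in> set_pmf (tilted_bin_pmf k p)"
proof -
  show "set_pmf (tilted_bin_pmf k p) \<subseteq> {1..k}"
    by (auto simp: set_pmf_eq pmf_tilted_bin_pmf[OF assms] bin_weight_def split: if_splits)
  have "(1 - p) ^ k < 1"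
    using assms by (intro power_less_one_iff[THEN iffD2]) auto
  thus "1 \<in> set_pmf (tilted_bin_pmf k p)"
    using assms by (auto simp: set_pmf_eq pmf_tilted_bin_pmf[OF assms] bin_weight_def)
qed

lemma Y_altdef:
  assumes "\<And>j. j \<in> {1..k-1} \<Longrightarrow> T j \<ge> 1"
  shows "Y k T t = 1 + int (card {j \<in> {1..k-1}. T j \<le> t}) - int t"
proof (induction t)
  case 0
  have "{j \<in> {1..k-1}. T j \<le> 0} = {}" using assms by fastforce
  thus ?case by simp
next
  case (Suc t)
  have "{j \<in> {1..k-1}. T j \<le> Suc t} = {j \<in> {1..k-1}. T j \<le> t} \<union> {j \<in> {1..k-1}. T j = Suc t}"
    by auto
  hence "card {j \<in> {1..k-1}. T j \<le> Suc t} = card {j \<in> {1..k-1}. T j \<le> t} + Z k T (Suc t)"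
    unfolding Z_def by (simp only:) (rule card_Un_disjoint, auto)
  thus ?case using Suc by simp
qed

lemma set_placement_pmf:
  assumes "k \<ge> 1" "0 < p" "p \<le> 1" "T \<in> set_pmf (placement_pmf k p)" "j \<in> {1..k-1}"
  shows "T j \<in> {1..k}"
proof -
  have "T \<in> PiE_dflt {1..k-1} 0 (\<lambda>_. set_pmf (tilted_bin_pmf k p))"
    using assms(4) set_Pi_pmf_subset'[of "{1..k-1}" 0] unfolding placement_pmf_def by (auto simp: o_def)
  hence "T j \<in> set_pmf (tilted_bin_pmf k p)"
    using assms(5) by (auto simp: PiE_dflt_def)
  thus ?thesis using set_tilted_bin_pmf(1)[OF assms(1-3)] by auto
qed

lemma TREE_possible:
  assumes "k \<ge> 1" "0 < p" "p \<le> 1"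
  shows "set_pmf (placement_pmf k p) \<inter> TREE k \<noteq> {}"
proof -
  define T :: "nat \<Rightarrow> nat" where "T = (\<lambda>j. if j \<in> {1..k-1} then 1 else 0)"
  have "T \<in> set_pmf (placement_pmf k p)"
    unfolding placement_pmf_def using set_tilted_bin_pmf(2)[OF assms]
    by (subst set_Pi_pmf) (auto simp: PiE_dflt_def T_def)
  moreover have "Y k T t > 0" if "t \<in> {1..k-1}" for t
  proof -
    have "{j \<in> {1..k-1}. T j \<le> t} = {1..k-1}" using that by (auto simp: T_def)
    thus ?thesis using that by (subst Y_altdef) (auto simp: T_def)
  qed
  ultimately show ?thesis by (auto simp: TREE_def)
qed

lemma Y_final:
  assumes "k \<ge> 1" "\<And>j. j \<in> {1..k-1} \<Longrightarrow> T j \<in> {1..k}"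
  shows "Y k T k = 0"
proof -
  have "{j \<in> {1..k-1}. T j \<le> k} = {1..k-1}" using assms by auto
  thus ?thesis using assms by (subst Y_altdef) auto
qed

lemma M_eq_sum_Y:
  assumes "k \<ge> 1" "\<And>j. j \<in> {1..k-1} \<Longrightarrow> T j \<in> {1..k}"
  shows "M k T = (\<Sum>t=1..k-1. Y k T t - 1)"
proof -
  have c: "(\<Sum>t=1..k-1. int (card {j \<in> {1..k-1}. T j \<le> t})) = (\<Sum>j=1..k-1. int k - int (T j))"
  proof -
    have "(\<Sum>t=1..k-1. int (card {j \<in> {1..k-1}. T j \<le> t}))
        = (\<Sum>t=1..k-1. \<Sum>j=1..k-1. if T j \<le> t then 1 else 0)"
      by (intro sum.cong refl) (simp add: sum.If_cases Int_def)
    also have "\<dots> = (\<Sum>j=1..k-1. \<Sum>t=1..k-1. if T j \<le> t then 1 else 0)"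
      by (rule sum.swap)
    also have "\<dots> = (\<Sum>j=1..k-1. int k - int (T j))"
    proof (intro sum.cong refl)
      fix j assume j: "j \<in> {1..k-1}"
      have "{1..k-1} \<inter> {t. T j \<le> t} = {T j..k-1}" using assms(2)[OF j] by auto
      thus "(\<Sum>t=1..k-1. if T j \<le> t then 1 else 0) = int k - int (T j)"
        using assms(1) assms(2)[OF j] by (simp add: sum.If_cases)
    qed
    finally show ?thesis .
  qed
  have "(\<Sum>t=1..k-1. Y k T t - 1) = (\<Sum>t=1..k-1. int (card {j \<in> {1..k-1}. T j \<le> t}) - int t)"
    using assms by (intro sum.cong refl, subst Y_altdef) auto
  also have "\<dots> = (\<Sum>j=1..k-1. int k - int (T j)) - (\<Sum>t=1..k-1. int t)"
    by (simp only: sum_subtractf c)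
  also have "\<dots> = (\<Sum>j=1..k-1. int k - int j) - (\<Sum>j=1..k-1. int (T j))"
    by (simp add: sum_subtractf)
  also have "(\<Sum>j=1..k-1. int k - int j) = (\<Sum>j=1..k-1. int j)"
    by (rule sum.reindex_bij_witness[of _ "\<lambda>j. k - j" "\<lambda>j. k - j"]) auto
  also have "\<dots> = int (k choose 2)"
    using assms(1)
  proof (induction k rule: dec_induct)
    case (step n)
    hence "{1..Suc n - 1} = insert n {1..n-1}" by auto
    thus ?case using step by (simp add: numeral_2_eq_2)
  qed auto
  finally show ?thesis by (simp add: M_def)
qed

lemma Mstar_nonneg:
  assumes "k \<ge> 1" "0 < p" "p \<le> 1" "m \<in> set_pmf (Mstar_pmf k p)"
  shows "m \<ge> 0"
proof -
  obtain T where T: "T \<in> set_pmf (placement_pmf k p)" "T \<in> TREE k" "m = M k T"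
    using assms(4) TREE_possible[OF assms(1-3)] by (auto simp: Mstar_pmf_def set_cond_pmf)
  have "M k T = (\<Sum>t=1..k-1. Y k T t - 1)"
    using assms(1) set_placement_pmf[OF assms(1-3) T(1)] by (intro M_eq_sum_Y) auto
  also have "\<dots> \<ge> 0"
    using T(2) by (intro sum_nonneg) (force simp: TREE_def)
  finally show ?thesis using T(3) by simp
qed

end

theory Submission
  imports Defs
begin

text \<open>
  On \<open>TREE\<close> the factors \<open>1 - (1 - p)^k\<close> cancel and the exponent of \<open>1 - p\<close> no longer depends on
  the placement \<open>T\<close>, so the claim reduces to the identity that \<open>C(k, l)\<close> is the sum over \<open>T\<close> in
  \<open>TREE\<close> of the binomial coefficients \<open>M(T)\<close> choose \<open>l\<close>. That identity is breadth-first search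
  from the root \<open>k\<close>: ball \<open>v < k\<close> is a vertex and \<open>T v\<close> is the time at which it is discovered, so
  the search visits the vertices in the lexicographic order of \<open>(T v, v)\<close>, the root coming first.
  A graph has search \<open>T\<close> iff \<open>T v\<close> is the least rank of a neighbour of \<open>v\<close>, for all \<open>v < k\<close>.
  A connected graph determines this fixed point \<open>T\<close> level by level, so it exists, is unique and lies
  in \<open>TREE\<close>. Conversely, the graphs with search \<open>T\<close> are those lying between the \<open>k - 1\<close> tree edges
  and a set of \<open>k - 1 + M(T)\<close> admissible edges.
\<close>

section \<open>Encoding of breadth-first search by placements\<close>

definition placements :: "nat \<Rightarrow> (nat \<Rightarrow> nat) set" where
  "placements k = PiE_dflt {1..k-1} 0 (\<lambda>_. {1..k})"

text \<open>The root \<open>k\<close> is not a ball, so placements give it the default value \<open>0\<close> and hence rank \<open>1\<close>.\<close>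

definition bfs_rank :: "nat \<Rightarrow> (nat \<Rightarrow> nat) \<Rightarrow> nat \<Rightarrow> nat" where
  "bfs_rank k T v = card {u \<in> {1..k}. T u < T v \<or> T u = T v \<and> u \<le> v}"

text \<open>Recomputes every discovery time from the visiting order given by \<open>T\<close>, so
  that the search of the graph \<open>E\<close> is a fixed point in \<open>T\<close>. The
  \<open>LEAST\<close> is meaningful once \<open>v\<close> has a neighbour, as it does in a
  connected graph (\<open>neighbour_exists\<close>).\<close>

definition bfs_step :: "nat \<Rightarrow> nat set set \<Rightarrow> (nat \<Rightarrow> nat) \<Rightarrow> nat \<Rightarrow> nat" where
  "bfs_step k E T v =
     (if v \<in> {1..k-1} then (LEAST s. \<exists>u\<in>{1..k}. {u, v} \<in> E \<and> bfs_rank k T u = s) else 0)"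

text \<open>The disjunction forces the level sets up to \<open>t\<close> to coincide: a vertex of
  level at most \<open>t\<close> for one function cannot lie higher for the other.\<close>

definition agree_upto :: "nat \<Rightarrow> (nat \<Rightarrow> nat) \<Rightarrow> (nat \<Rightarrow> nat) \<Rightarrow> bool" where
  "agree_upto t f g \<longleftrightarrow> (\<forall>v. f v \<le> t \<or> g v \<le> t \<longrightarrow> f v = g v)"

text \<open>Each non-root vertex is joined to its parent, the vertex being visited at the time of
  its discovery.\<close>

definition tree_edges :: "nat \<Rightarrow> (nat \<Rightarrow> nat) \<Rightarrow> nat set set" where
  "tree_edges k T = {{u, v} | u v. v \<in> {1..k-1} \<and> u \<in> {1..k} \<and> bfs_rank k T u = T v}"

text \<open>An edge from \<open>v\<close> back to a vertex visited before the parent of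
  \<open>v\<close> is forbidden, because it would have led to an earlier discovery of
  \<open>v\<close>.\<close>

definition admissible_edges :: "nat \<Rightarrow> (nat \<Rightarrow> nat) \<Rightarrow> nat set set" where
  "admissible_edges k T =
     {{u, v} | u v. v \<in> {1..k-1} \<and> u \<in> {1..k} \<and>
        T v \<le> bfs_rank k T u \<and> bfs_rank k T u < bfs_rank k T v}"

lemma placementsD:
  assumes "T \<in> placements k"
  shows "j \<in> {1..k-1} \<Longrightarrow> 1 \<le> T j \<and> T j \<le> k" "j \<notin> {1..k-1} \<Longrightarrow> T j = 0"
  using assms by (auto simp: placements_def PiE_dflt_def)

lemma placementsI:
  assumes "\<And>j. j \<in> {1..k-1} \<Longrightarrow> T j \<in> {1..k}" "\<And>j. j \<notin> {1..k-1} \<Longrightarrow> T j = 0"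
  shows "T \<in> placements k"
  using assms by (auto simp: placements_def PiE_dflt_def)

lemma finite_placements: "finite (placements k)"
  unfolding placements_def by (intro finite_PiE_dflt) auto

section \<open>The visiting order and the \<open>TREE\<close> condition\<close>

lemma bfs_rank_less:
  assumes "v \<in> {1..k}" "T u < T v \<or> T u = T v \<and> u < v"
  shows "bfs_rank k T u < bfs_rank k T v"
  unfolding bfs_rank_def
proof (rule psubset_card_mono)
  have "v \<notin> {w \<in> {1..k}. T w < T u \<or> T w = T u \<and> w \<le> u}" using assms by auto
  moreover have "v \<in> {w \<in> {1..k}. T w < T v \<or> T w = T v \<and> w \<le> v}" using assms by auto
  ultimately show "{w \<in> {1..k}. T w < T u \<or> T w = T u \<and> w \<le> u}
      \<subset> {w \<in> {1..k}. T w < T v \<or> T w = T v \<and> w \<le> v}"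
    using assms(2) by auto
qed auto

text \<open>The lexicographic order of \<open>(T v, v)\<close> is total, so distinct vertices have
  distinct ranks; an injection of a finite set into itself is onto. Ranks are thus visiting
  times.\<close>

lemma bij_betw_bfs_rank: "bij_betw (bfs_rank k T) {1..k} {1..k}"
proof -
  have inj: "inj_on (bfs_rank k T) {1..k}"
  proof (rule inj_onI)
    fix u v assume uv: "u \<in> {1..k}" "v \<in> {1..k}" "bfs_rank k T u = bfs_rank k T v"
    show "u = v"
    proof (rule ccontr)
      assume "u \<noteq> v"
      hence "(T u < T v \<or> T u = T v \<and> u < v) \<or> (T v < T u \<or> T v = T u \<and> v < u)" by linarith
      thus False using bfs_rank_less[OF uv(1), of T v] bfs_rank_less[OF uv(2), of T u] uv(3) by auto
    qed
  qed
  have "bfs_rank k T v \<in> {1..k}" if "v \<in> {1..k}" for v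
  proof -
    have "card {v} \<le> bfs_rank k T v"
      unfolding bfs_rank_def using that by (intro card_mono) auto
    moreover have "bfs_rank k T v \<le> card {1..k}"
      unfolding bfs_rank_def by (intro card_mono) auto
    ultimately show ?thesis by simp
  qed
  hence "bfs_rank k T ` {1..k} = {1..k}"
    by (intro endo_inj_surj inj) auto
  thus ?thesis using inj by (simp add: bij_betw_def)
qed

lemma bfs_rank_in: "v \<in> {1..k} \<Longrightarrow> bfs_rank k T v \<in> {1..k}"
  using bij_betw_bfs_rank[of k T] by (auto simp: bij_betw_def)

lemma bfs_rank_inj:
  "u \<in> {1..k} \<Longrightarrow> v \<in> {1..k} \<Longrightarrow> bfs_rank k T u = bfs_rank k T v \<Longrightarrow> u = v"
  using inj_onD[OF bij_betw_imp_inj_on[OF bij_betw_bfs_rank]] by metis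

lemma bfs_rank_surj: "s \<in> {1..k} \<Longrightarrow> \<exists>u\<in>{1..k}. bfs_rank k T u = s"
  using bij_betw_bfs_rank[of k T] by (metis bij_betw_imp_surj_on imageE)

lemma bfs_rank_root:
  assumes "T \<in> placements k" "k \<ge> 1"
  shows "bfs_rank k T k = 1"
proof -
  have "{u \<in> {1..k}. T u < T k \<or> T u = T k \<and> u \<le> k} = {k}"
  proof (intro equalityI subsetI)
    fix u assume u: "u \<in> {u \<in> {1..k}. T u < T k \<or> T u = T k \<and> u \<le> k}"
    have "T k = 0" using placementsD(2)[OF assms(1), of k] assms(2) by auto
    hence "T u = 0" using u by auto
    thus "u \<in> {k}" using placementsD(1)[OF assms(1), of u] u by force
  qed (use assms in auto)
  thus ?thesis by (simp add: bfs_rank_def)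
qed

text \<open>\<open>Y k T t\<close> is the length of the search queue after \<open>t\<close> visits:
  the vertices discovered so far, the root being the summand 1, minus the \<open>t\<close> visited
  ones.\<close>

lemma TREE_iff_card:
  assumes "T \<in> placements k"
  shows "T \<in> TREE k \<longleftrightarrow> (\<forall>t\<in>{1..k-1}. t \<le> card {j \<in> {1..k-1}. T j \<le> t})"
proof -
  have "Y k T t = 1 + int (card {j \<in> {1..k-1}. T j \<le> t}) - int t" for t
    by (rule Y_altdef) (use placementsD(1)[OF assms] in auto)
  thus ?thesis by (auto simp: TREE_def)
qed

lemma card_level_set:
  assumes "T \<in> placements k" "k \<ge> 1"
  shows "card {v \<in> {1..k}. T v \<le> t} = Suc (card {j \<in> {1..k-1}. T j \<le> t})"
proof -
  have "T k = 0" using placementsD(2)[OF assms(1), of k] assms(2) by auto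
  hence "{v \<in> {1..k}. T v \<le> t} = insert k {j \<in> {1..k-1}. T j \<le> t}"
    using assms(2) by auto
  moreover have "k \<notin> {j \<in> {1..k-1}. T j \<le> t}" using assms(2) by auto
  ultimately show ?thesis
    by (metis card_insert_disjoint finite_Collect_conjI finite_atLeastAtMost Collect_mem_eq)
qed

text \<open>A vertex is visited strictly after its parent: by \<open>TREE\<close> and the extra
  root, at least \<open>T v\<close> vertices have a level below \<open>T v\<close>, and all of them
  precede \<open>v\<close>.\<close>

lemma TREE_less_bfs_rank:
  assumes T: "T \<in> placements k" "T \<in> TREE k" and v: "v \<in> {1..k-1}"
  shows "T v < bfs_rank k T v"
proof -
  define t where "t = T v - 1"
  have Tv: "T v = Suc t" "t \<le> k - 1" using placementsD(1)[OF T(1) v] by (auto simp: t_def)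
  \<comment> \<open>\<open>TREE\<close> constrains only times from 1 on; at \<open>t = 0\<close> the
    bound is trivial.\<close>
  have "t \<le> card {j \<in> {1..k-1}. T j \<le> t}"
    using T Tv(2) TREE_iff_card[OF T(1)] by (cases "t = 0") auto
  hence "T v \<le> card {u \<in> {1..k}. T u \<le> t}"
    using card_level_set[OF T(1)] v Tv by auto
  also have "\<dots> < card (insert v {u \<in> {1..k}. T u \<le> t})"
    using Tv by auto
  also have "\<dots> \<le> bfs_rank k T v"
    unfolding bfs_rank_def using v Tv by (intro card_mono) auto
  finally show ?thesis .
qed

section \<open>Existence and uniqueness of the search of a connected graph\<close>

lemma connected_graph_closed_set:
  assumes "connected_graph V E" "r \<in> V" "r \<in> S"
    and "\<And>u v. u \<in> S \<Longrightarrow> {u, v} \<in> E \<Longrightarrow> v \<in> S"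
  shows "V \<subseteq> S"
proof
  fix v assume "v \<in> V"
  hence "(r, v) \<in> {(x, y). {x, y} \<in> E}\<^sup>*" using assms(1,2) by (auto simp: connected_graph_def)
  thus "v \<in> S" by (induction rule: rtrancl_induct) (use assms(3,4) in auto)
qed

lemma bfs_step_le:
  assumes "v \<in> {1..k-1}" "u \<in> {1..k}" "{u, v} \<in> E"
  shows "bfs_step k E T v \<le> bfs_rank k T u"
  using assms unfolding bfs_step_def by (auto intro!: Least_le)

lemma bfs_step_witness:
  assumes "v \<in> {1..k-1}" "\<exists>u\<in>{1..k}. {u, v} \<in> E"
  obtains u where "u \<in> {1..k}" "{u, v} \<in> E" "bfs_rank k T u = bfs_step k E T v"
proof -
  have "\<exists>u\<in>{1..k}. {u, v} \<in> E \<and> bfs_rank k T u = (LEAST s. \<exists>u\<in>{1..k}. {u, v} \<in> E \<and> bfs_rank k T u = s)"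
    by (rule LeastI_ex) (use assms(2) in blast)
  thus ?thesis using that assms(1) by (auto simp: bfs_step_def)
qed

locale connected_on =
  fixes k :: nat and E :: "nat set set"
  assumes k: "k \<ge> 1"
    and edges: "E \<subseteq> {e. e \<subseteq> {1..k} \<and> card e = 2}"
    and connected: "connected_graph {1..k} E"
begin

lemma edge_in: "{u, v} \<in> E \<Longrightarrow> u \<in> {1..k} \<and> v \<in> {1..k} \<and> u \<noteq> v"
  using edges by auto

text \<open>An isolated \<open>v\<close> would form a closed set by itself, yet the root lies
  outside it.\<close>

lemma neighbour_exists:
  assumes "v \<in> {1..k-1}"
  shows "\<exists>u\<in>{1..k}. {u, v} \<in> E"
proof (rule ccontr)
  assume "\<not> ?thesis"
  hence "{1..k} \<subseteq> {v}"
    by (intro connected_graph_closed_set[OF connected, of v])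
      (use assms edge_in in \<open>auto simp: insert_commute\<close>)
  moreover have "k \<in> {1..k}" "v \<noteq> k" using assms by auto
  ultimately show False by blast
qed

lemma bfs_step_placements: "bfs_step k E T \<in> placements k"
proof (rule placementsI)
  fix v assume v: "v \<in> {1..k-1}"
  obtain u where "u \<in> {1..k}" "bfs_rank k T u = bfs_step k E T v"
    using bfs_step_witness[OF v neighbour_exists[OF v]] by metis
  thus "bfs_step k E T v \<in> {1..k}" using bfs_rank_in by metis
qed (auto simp: bfs_step_def)

text \<open>Otherwise the vertices of level at most \<open>t\<close> would be closed under adjacency.\<close>

lemma card_level_set_gt:
  assumes T: "T \<in> placements k" "agree_upto t T (bfs_step k E T)" and t: "t < k"
  shows "t < card {v \<in> {1..k}. T v \<le> t}"
proof (rule ccontr)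
  define S where "S = {v \<in> {1..k}. T v \<le> t}"
  assume "\<not> ?thesis"
  hence S: "card S \<le> t" by (simp add: S_def)
  have "k \<in> S" using placementsD(2)[OF T(1), of k] k by (auto simp: S_def)
  moreover have "v \<in> S" if uv: "u \<in> S" "{u, v} \<in> E" for u v
  proof (cases "v = k")
    case False
    hence v: "v \<in> {1..k-1}" using edge_in[OF uv(2)] by auto
    \<comment> \<open>Whatever does not come after \<open>u\<close> in the visiting order has level
      at most \<open>t\<close> as well, hence lies in \<open>S\<close>.\<close>
    have "bfs_rank k T u \<le> card S"
      unfolding bfs_rank_def using uv(1) by (intro card_mono) (auto simp: S_def)
    hence "bfs_step k E T v \<le> t"
      using bfs_step_le[OF v _ uv(2), of T] edge_in[OF uv(2)] S by force
    hence "T v \<le> t" using T(2) unfolding agree_upto_def by metis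
    thus ?thesis using v by (auto simp: S_def)
  qed (use \<open>k \<in> S\<close> in simp)
  ultimately have "{1..k} \<subseteq> S"
    using connected_graph_closed_set[OF connected, of k S] k by auto
  hence "card {1..k} \<le> card S" by (intro card_mono) (auto simp: S_def)
  thus False using S t by simp
qed

text \<open>The induction step for both existence and uniqueness. More than \<open>t\<close>
  vertices have level at most \<open>t\<close>, so these include all vertices of rank up to
  \<open>Suc t\<close>; their ranks depend on the levels up to \<open>t\<close> alone, and so do the
  new discovery times up to \<open>Suc t\<close>.\<close>

lemma bfs_step_agree_Suc:
  assumes T: "T \<in> placements k" "agree_upto t T (bfs_step k E T)"
    and agree: "agree_upto t T T'" and t: "t < k"
  shows "agree_upto (Suc t) (bfs_step k E T) (bfs_step k E T')"
proof -
  define S where "S = {v \<in> {1..k}. T v \<le> t}"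
  have agreeD: "T w = T' w" if "T w \<le> t \<or> T' w \<le> t" for w
    using agree that unfolding agree_upto_def by blast
  have S': "S = {v \<in> {1..k}. T' v \<le> t}"
    unfolding S_def by (intro Collect_cong conj_cong refl) (metis agreeD)
  have cardS: "t < card S" using card_level_set_gt[OF T t] by (simp add: S_def)
  \<comment> \<open>A vertex outside \<open>S\<close> comes after all of \<open>S\<close>, so its
    rank is at least \<open>card S + 1\<close>, which exceeds \<open>Suc t\<close>.\<close>
  have in_S: "u \<in> S" if "u \<in> {1..k}" "bfs_rank k U u \<le> Suc t" "S = {v \<in> {1..k}. U v \<le> t}" for u U
  proof (rule ccontr)
    assume u: "u \<notin> S"
    have "Suc (card S) = card (insert u S)" using u by (simp add: S_def)
    also have "\<dots> \<le> bfs_rank k U u"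
      unfolding bfs_rank_def using u that(1,3) by (intro card_mono) auto
    finally show False using cardS that(2) by simp
  qed
  have rank_S: "bfs_rank k T u = bfs_rank k T' u" if "u \<in> S" for u
  proof -
    have "T u \<le> t" using that by (simp add: S_def)
    moreover from this have "T u = T' u" using agreeD by blast
    ultimately have "{w \<in> {1..k}. T w < T u \<or> T w = T u \<and> w \<le> u} =
        {w \<in> {1..k}. T' w < T' u \<or> T' w = T' u \<and> w \<le> u}"
      by (intro Collect_cong) (metis agreeD less_or_eq_imp_le order.trans)
    thus ?thesis by (simp add: bfs_rank_def)
  qed
  \<comment> \<open>Stated for generic \<open>U\<close> and \<open>U'\<close> so as to be used in
    both directions: a value at most \<open>Suc t\<close> on one side bounds the other side, and
    then the converse inequality applies too.\<close>
  have le: "bfs_step k E U' v \<le> bfs_step k E U v"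
    if U: "bfs_step k E U v \<le> Suc t" "v \<in> {1..k-1}" "S = {v \<in> {1..k}. U v \<le> t}"
      "\<And>u. u \<in> S \<Longrightarrow> bfs_rank k U u = bfs_rank k U' u" for U U' v
  proof -
    obtain u where u: "u \<in> {1..k}" "{u, v} \<in> E" "bfs_rank k U u = bfs_step k E U v"
      using bfs_step_witness[OF U(2) neighbour_exists[OF U(2)]] by metis
    hence "u \<in> S" using in_S U(1,3) by simp
    thus ?thesis using bfs_step_le[OF U(2) u(1,2), of U'] U(4) u(3) by simp
  qed
  show ?thesis
    unfolding agree_upto_def
  proof (intro allI impI)
    fix v assume v: "bfs_step k E T v \<le> Suc t \<or> bfs_step k E T' v \<le> Suc t"
    show "bfs_step k E T v = bfs_step k E T' v"
    proof (cases "v \<in> {1..k-1}")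
      case True
      show ?thesis
        using v le[of T v T', OF _ True S_def] le[of T' v T, OF _ True S'] rank_S by force
    qed (auto simp: bfs_step_def)
  qed
qed

text \<open>Every placement has the same level 0, the complement of the balls.\<close>

lemma agree_upto_0:
  assumes "T \<in> placements k" "T' \<in> placements k"
  shows "agree_upto 0 T T'"
  unfolding agree_upto_def
  using placementsD[OF assms(1)] placementsD[OF assms(2)] by (metis le_zero_eq not_one_le_zero)

lemma agree_upto_eq:
  assumes "T \<in> placements k" "T' \<in> placements k" "agree_upto k T T'"
  shows "T = T'"
proof
  fix v show "T v = T' v"
  proof (cases "v \<in> {1..k-1}")
    case True
    thus ?thesis using placementsD(1)[OF assms(1)] assms(3) unfolding agree_upto_def by blast
  qed (simp add: placementsD(2)[OF assms(1)] placementsD(2)[OF assms(2)])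
qed

text \<open>Iterating \<open>bfs_step\<close> from any start settles one more level each time, and
  no level exceeds \<open>k\<close>.\<close>

lemma bfs_fixpoint_exists: "\<exists>T \<in> placements k. T = bfs_step k E T"
proof -
  have "\<exists>T \<in> placements k. agree_upto t T (bfs_step k E T)" if "t \<le> k" for t
    using that
  proof (induction t)
    case 0
    show ?case using bfs_step_placements agree_upto_0 by blast
  next
    case (Suc t)
    then obtain T where "T \<in> placements k" "agree_upto t T (bfs_step k E T)" by auto
    thus ?case using bfs_step_agree_Suc[of T t "bfs_step k E T"] Suc.prems bfs_step_placements by auto
  qed
  thus ?thesis using agree_upto_eq bfs_step_placements by blast
qed

lemma bfs_fixpoint_unique:
  assumes "T \<in> placements k" "T = bfs_step k E T" "T' \<in> placements k" "T' = bfs_step k E T'"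
  shows "T = T'"
proof -
  have "agree_upto t T T'" if "t \<le> k" for t
    using that
  proof (induction t)
    case 0
    show ?case by (rule agree_upto_0[OF assms(1,3)])
  next
    case (Suc t)
    have "agree_upto t T (bfs_step k E T)" by (simp add: agree_upto_def flip: assms(2))
    thus ?case
      using bfs_step_agree_Suc[OF assms(1), of t T'] Suc by (simp flip: assms(2,4))
  qed
  thus ?thesis using agree_upto_eq[OF assms(1,3)] by blast
qed

text \<open>The strict inequality of \<open>card_level_set_gt\<close> pays for the root, which is in
  the level set but is not a ball.\<close>

lemma bfs_fixpoint_TREE:
  assumes "T \<in> placements k" "T = bfs_step k E T"
  shows "T \<in> TREE k"
proof -
  have "t \<le> card {j \<in> {1..k-1}. T j \<le> t}" if "t \<in> {1..k-1}" for t
  proof -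
    have "agree_upto t T (bfs_step k E T)" by (simp add: agree_upto_def flip: assms(2))
    moreover have "t < k" using that by auto
    ultimately have "t < card {v \<in> {1..k}. T v \<le> t}" by (rule card_level_set_gt[OF assms(1)])
    thus ?thesis using card_level_set[OF assms(1) k, of t] by simp
  qed
  thus ?thesis using TREE_iff_card[OF assms(1)] by blast
qed

text \<open>The neighbour of \<open>v\<close> of least rank has rank \<open>T v\<close>, and by
  injectivity of ranks it is the parent. For the upper bound, each edge is oriented from its earlier
  to its later end.\<close>

lemma bfs_fixpoint_edges:
  assumes T: "T \<in> placements k" "T = bfs_step k E T"
  shows "tree_edges k T \<subseteq> E" "E \<subseteq> admissible_edges k T"
proof -
  show "tree_edges k T \<subseteq> E"
  proof
    fix e assume "e \<in> tree_edges k T"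
    then obtain u v where uv: "e = {u, v}" "v \<in> {1..k-1}" "u \<in> {1..k}" "bfs_rank k T u = T v"
      by (auto simp: tree_edges_def)
    obtain u' where "u' \<in> {1..k}" "{u', v} \<in> E" "bfs_rank k T u' = T v"
      using bfs_step_witness[OF uv(2) neighbour_exists[OF uv(2)]] T(2) by metis
    thus "e \<in> E" using bfs_rank_inj uv by metis
  qed
  have *: "{u, v} \<in> admissible_edges k T" if "{u, v} \<in> E" "bfs_rank k T u < bfs_rank k T v" for u v
  proof -
    have uv: "u \<in> {1..k}" "v \<in> {1..k}" using edge_in[OF that(1)] by auto
    \<comment> \<open>The root has rank 1, so it is never the later end of an edge.\<close>
    have "v \<noteq> k" using bfs_rank_root[OF T(1) k] bfs_rank_in[OF uv(1), of T] that(2) by auto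
    hence v: "v \<in> {1..k-1}" using uv by auto
    have "T v \<le> bfs_rank k T u" using bfs_step_le[OF v uv(1) that(1), of T] by (simp flip: T(2))
    thus ?thesis using v uv that(2) by (auto simp: admissible_edges_def)
  qed
  show "E \<subseteq> admissible_edges k T"
  proof
    fix e assume e: "e \<in> E"
    then obtain u v where uv: "e = {u, v}" "u \<noteq> v" using edges by (auto simp: card_2_iff)
    have "bfs_rank k T u \<noteq> bfs_rank k T v"
      using edge_in[of u v] bfs_rank_inj[of u k v T] uv e by auto
    thus "e \<in> admissible_edges k T"
      using *[of u v] *[of v u] uv e by (metis insert_commute linorder_neqE_nat)
  qed
qed

end

section \<open>Graphs with a prescribed search\<close>

lemma admissible_edges_subset:
  "admissible_edges k T \<subseteq> {e. e \<subseteq> {1..k} \<and> card e = 2}"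
  by (auto simp: admissible_edges_def card_insert_if)

text \<open>The parent edge bounds the step by \<open>T v\<close> from above. From below, a
  neighbour visited before \<open>v\<close> has rank at least \<open>T v\<close> by admissibility,
  and one visited after \<open>v\<close> does because \<open>TREE\<close> puts \<open>v\<close>
  itself after time \<open>T v\<close>.\<close>

lemma between_edges_fixpoint:
  assumes T: "T \<in> placements k" "T \<in> TREE k"
    and E: "tree_edges k T \<subseteq> E" "E \<subseteq> admissible_edges k T"
  shows "T = bfs_step k E T"
proof
  fix v
  show "T v = bfs_step k E T v"
  proof (cases "v \<in> {1..k-1}")
    case True
    have "T v \<in> {1..k}" using placementsD(1)[OF T(1) True] by simp
    then obtain u where u: "u \<in> {1..k}" "bfs_rank k T u = T v" using bfs_rank_surj by metis
    hence uE: "{u, v} \<in> E" using True E(1) by (auto simp: tree_edges_def)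
    obtain w where w: "w \<in> {1..k}" "{w, v} \<in> E" "bfs_rank k T w = bfs_step k E T v"
      using bfs_step_witness[OF True] u(1) uE by metis
    from w(2) E(2) have "{w, v} \<in> admissible_edges k T" by blast
    then consider "T v \<le> bfs_rank k T w" | "bfs_rank k T v < bfs_rank k T w"
      by (auto simp: admissible_edges_def doubleton_eq_iff)
    hence "T v \<le> bfs_rank k T w"
      using TREE_less_bfs_rank[OF T True] by cases auto
    thus ?thesis using bfs_step_le[OF True u(1) uE, of T] u w by simp
  qed (use placementsD[OF T(1)] in \<open>auto simp: bfs_step_def\<close>)
qed

text \<open>Passing to the parent strictly lowers the rank, so every vertex reaches the
  root.\<close>

lemma between_edges_connected:
  assumes T: "T \<in> placements k" "T \<in> TREE k" and E: "tree_edges k T \<subseteq> E"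
  shows "connected_graph {1..k} E"
proof -
  define R where "R = {(x, y). {x, y} \<in> E}"
  have "sym R" by (auto simp: R_def sym_def insert_commute)
  have root: "(v, k) \<in> R\<^sup>*" if "v \<in> {1..k}" for v
    using that
  proof (induction "bfs_rank k T v" arbitrary: v rule: less_induct)
    case less
    show ?case
    proof (cases "v = k")
      case False
      hence v: "v \<in> {1..k-1}" using less.prems by auto
      have "T v \<in> {1..k}" using placementsD(1)[OF T(1) v] by simp
      then obtain u where u: "u \<in> {1..k}" "bfs_rank k T u = T v" using bfs_rank_surj by metis
      hence "{u, v} \<in> E" using v E by (auto simp: tree_edges_def)
      hence "(v, u) \<in> R" by (simp add: R_def insert_commute)
      moreover have "(u, k) \<in> R\<^sup>*"
        using less.hyps[OF _ u(1)] TREE_less_bfs_rank[OF T v] u(2) by simp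
      ultimately show ?thesis by (rule converse_rtrancl_into_rtrancl)
    qed simp
  qed
  have "(u, v) \<in> R\<^sup>*" if "u \<in> {1..k}" "v \<in> {1..k}" for u v
    using root[OF that(1)] symD[OF sym_rtrancl[OF \<open>sym R\<close>] root[OF that(2)]] by (rule rtrancl_trans)
  thus ?thesis by (simp add: connected_graph_def R_def)
qed

section \<open>Counting edges and graphs\<close>

lemma card_image_edges:
  assumes less: "\<And>v u. (v, u) \<in> P \<Longrightarrow> (r u :: nat) < r v"
  shows "card {{u, v} | u v. (v, u) \<in> P} = card P"
proof -
  have "{{u, v} | u v. (v, u) \<in> P} = (\<lambda>(v, u). {u, v}) ` P" by force
  \<comment> \<open>The end with the larger \<open>r\<close> is the first component, so the
    unordered edge determines the pair.\<close>
  moreover have "inj_on (\<lambda>(v, u). {u, v}) P"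
  proof (rule inj_onI, clarsimp)
    fix v u v' u' assume "(v, u) \<in> P" "(v', u') \<in> P" "{u, v} = {u', v'}"
    thus "v = v' \<and> u = u'"
      using less[of v u] less[of v' u'] by (auto simp: doubleton_eq_iff)
  qed
  ultimately show ?thesis by (simp add: card_image)
qed

lemma card_tree_edges:
  assumes T: "T \<in> placements k" "T \<in> TREE k"
  shows "card (tree_edges k T) = k - 1"
proof -
  define P where "P = Sigma {1..k-1} (\<lambda>v. {u \<in> {1..k}. bfs_rank k T u = T v})"
  have "card {u \<in> {1..k}. bfs_rank k T u = T v} = 1" if "v \<in> {1..k-1}" for v
  proof -
    have "T v \<in> {1..k}" using placementsD(1)[OF T(1) that] by simp
    then obtain u where u: "u \<in> {1..k}" "bfs_rank k T u = T v" using bfs_rank_surj by metis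
    have "w = u" if "w \<in> {1..k}" "bfs_rank k T w = T v" for w
      using bfs_rank_inj[OF that(1) u(1), of T] that(2) u(2) by simp
    hence "{u \<in> {1..k}. bfs_rank k T u = T v} = {u}" using u by blast
    thus ?thesis by (metis card_1_singleton_iff One_nat_def)
  qed
  hence "card P = k - 1" unfolding P_def by (subst card_SigmaI) auto
  moreover have "card {{u, v} | u v. (v, u) \<in> P} = card P"
    by (rule card_image_edges[where r = "bfs_rank k T"])
      (use TREE_less_bfs_rank[OF T] in \<open>auto simp: P_def\<close>)
  moreover have "tree_edges k T = {{u, v} | u v. (v, u) \<in> P}"
    by (simp add: tree_edges_def P_def)
  ultimately show ?thesis by simp
qed

lemma sum_upto_choose_two: "(\<Sum>t=1..k. int t) = int (k choose 2) + int k"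
  by (induction k) (auto simp: numeral_2_eq_2)

text \<open>The earlier end of an admissible edge at \<open>v\<close> takes any rank from
  \<open>T v\<close> up to just below the rank of \<open>v\<close>; summing these interval lengths
  leaves the sum of all ranks minus the sum of the levels.\<close>

lemma card_admissible_edges:
  assumes T: "T \<in> placements k" "T \<in> TREE k" and k: "k \<ge> 1"
  shows "int (card (admissible_edges k T)) = M k T + int (k - 1)"
proof -
  define P where
    "P = Sigma {1..k-1} (\<lambda>v. {u \<in> {1..k}. T v \<le> bfs_rank k T u \<and> bfs_rank k T u < bfs_rank k T v})"
  have "int (card {u \<in> {1..k}. T v \<le> bfs_rank k T u \<and> bfs_rank k T u < bfs_rank k T v})
      = int (bfs_rank k T v) - int (T v)" if v: "v \<in> {1..k-1}" for v
  proof -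
    have Tv: "1 \<le> T v" "T v < bfs_rank k T v" "bfs_rank k T v \<le> k"
      using placementsD(1)[OF T(1) v] TREE_less_bfs_rank[OF T v] bfs_rank_in[of v k T] v by auto
    have "bij_betw (bfs_rank k T)
        {u \<in> {1..k}. T v \<le> bfs_rank k T u \<and> bfs_rank k T u < bfs_rank k T v} {T v..<bfs_rank k T v}"
      unfolding bij_betw_def
    proof
      show "inj_on (bfs_rank k T)
          {u \<in> {1..k}. T v \<le> bfs_rank k T u \<and> bfs_rank k T u < bfs_rank k T v}"
        by (rule inj_on_subset[OF bij_betw_imp_inj_on[OF bij_betw_bfs_rank]]) auto
      show "bfs_rank k T ` {u \<in> {1..k}. T v \<le> bfs_rank k T u \<and> bfs_rank k T u < bfs_rank k T v}
          = {T v..<bfs_rank k T v}"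
      proof (intro equalityI subsetI)
        fix s assume s: "s \<in> {T v..<bfs_rank k T v}"
        hence "s \<in> {1..k}" using Tv by auto
        then obtain u where "u \<in> {1..k}" "bfs_rank k T u = s" using bfs_rank_surj by metis
        thus "s \<in> bfs_rank k T ` {u \<in> {1..k}. T v \<le> bfs_rank k T u \<and> bfs_rank k T u < bfs_rank k T v}"
          using s by auto
      qed auto
    qed
    from bij_betw_same_card[OF this] show ?thesis using Tv by simp
  qed
  hence "int (card P) = (\<Sum>v=1..k-1. int (bfs_rank k T v) - int (T v))"
    by (simp add: P_def)
  also have "\<dots> = (\<Sum>v=1..k-1. int (bfs_rank k T v)) - (\<Sum>v=1..k-1. int (T v))"
    by (simp add: sum_subtractf)
  \<comment> \<open>The subtracted 1 is the rank of the root; with the root included, the ranks run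
    over all of \<open>{1..k}\<close>.\<close>
  also have "(\<Sum>v=1..k-1. int (bfs_rank k T v)) = (\<Sum>v=1..k. int (bfs_rank k T v)) - 1"
  proof -
    have "{1..k} = insert k {1..k-1}" using k by auto
    thus ?thesis using k bfs_rank_root[OF T(1) k] by simp
  qed
  also have "(\<Sum>v=1..k. int (bfs_rank k T v)) = (\<Sum>t=1..k. int t)"
    by (rule sum.reindex_bij_betw[OF bij_betw_bfs_rank])
  finally have "int (card P) = M k T + int (k - 1)"
    unfolding sum_upto_choose_two using k by (simp add: M_def)
  moreover have "card {{u, v} | u v. (v, u) \<in> P} = card P"
    by (rule card_image_edges[where r = "bfs_rank k T"]) (auto simp: P_def)
  moreover have "admissible_edges k T = {{u, v} | u v. (v, u) \<in> P}"
    by (simp add: admissible_edges_def P_def)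
  ultimately show ?thesis by simp
qed

lemma card_sets_between:
  assumes "finite B" "A \<subseteq> B"
  shows "card {E. A \<subseteq> E \<and> E \<subseteq> B \<and> card E = card A + l} = (card B - card A) choose l"
proof -
  have fin: "finite A" using assms finite_subset by blast
  have "bij_betw (\<lambda>X. A \<union> X) {X. X \<subseteq> B - A \<and> card X = l}
      {E. A \<subseteq> E \<and> E \<subseteq> B \<and> card E = card A + l}"
  proof (rule bij_betw_byWitness[where f' = "\<lambda>E. E - A"])
    show "(\<lambda>X. A \<union> X) ` {X. X \<subseteq> B - A \<and> card X = l}
        \<subseteq> {E. A \<subseteq> E \<and> E \<subseteq> B \<and> card E = card A + l}"
    proof clarify
      fix X assume X: "X \<subseteq> B - A"
      hence "finite X" using assms(1) finite_subset by blast
      hence "card (A \<union> X) = card A + card X"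
        using X fin by (intro card_Un_disjoint) auto
      thus "A \<subseteq> A \<union> X \<and> A \<union> X \<subseteq> B \<and> card (A \<union> X) = card A + card X" using X assms(2) by auto
    qed
  qed (use fin in \<open>auto simp: card_Diff_subset\<close>)
  hence "card {E. A \<subseteq> E \<and> E \<subseteq> B \<and> card E = card A + l} = card {X. X \<subseteq> B - A \<and> card X = l}"
    by (rule bij_betw_same_card[symmetric])
  also have "\<dots> = (card B - card A) choose l"
    using assms fin by (simp add: n_subsets card_Diff_subset)
  finally show ?thesis .
qed

lemma tree_edges_admissible:
  assumes "T \<in> placements k" "T \<in> TREE k"
  shows "tree_edges k T \<subseteq> admissible_edges k T"
proof
  fix e assume "e \<in> tree_edges k T"
  then obtain u v where "e = {u, v}" "v \<in> {1..k-1}" "u \<in> {1..k}" "bfs_rank k T u = T v"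
    by (auto simp: tree_edges_def)
  moreover from this have "bfs_rank k T u < bfs_rank k T v"
    using TREE_less_bfs_rank[OF assms] by simp
  ultimately show "e \<in> admissible_edges k T"
    unfolding admissible_edges_def mem_Collect_eq by (intro exI[of _ u] exI[of _ v]) simp
qed

text \<open>Connected graphs are classified by their search: existence of the fixed point makes the
  classes \<open>G T\<close> cover, uniqueness makes them disjoint. In a class the tree edges are
  forced and \<open>l\<close> of the \<open>M k T\<close> optional edges are chosen.\<close>

lemma num_connected_graphs_eq_sum:
  assumes k: "k \<ge> 1"
  shows "num_connected_graphs k l = (\<Sum>T \<in> placements k \<inter> TREE k. nat (M k T) choose l)"
proof -
  define G where "G T = {E. tree_edges k T \<subseteq> E \<and> E \<subseteq> admissible_edges k T \<and>
      card E = card (tree_edges k T) + l}" for T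
  have fin: "finite (admissible_edges k T)" for T
    by (rule finite_subset[OF admissible_edges_subset]) (auto intro: finite_subset[of _ "Pow {1..k}"])
  have conn: "connected_on k E" "T = bfs_step k E T"
    if "T \<in> placements k \<inter> TREE k" "E \<in> G T" for T E
    using that k admissible_edges_subset[of k T] between_edges_connected[of T k E]
      between_edges_fixpoint[of T k E]
    by (auto simp: connected_on_def G_def)
  have "{E. E \<subseteq> {e. e \<subseteq> {1..k} \<and> card e = 2} \<and> card E = k - 1 + l \<and> connected_graph {1..k} E}
      = (\<Union>T \<in> placements k \<inter> TREE k. G T)" (is "?L = ?R")
  proof (intro equalityI subsetI)
    fix E assume E: "E \<in> ?L"
    interpret connected_on k E using E k by unfold_locales auto
    obtain T where T: "T \<in> placements k" "T = bfs_step k E T" using bfs_fixpoint_exists by blast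
    hence "T \<in> TREE k" using bfs_fixpoint_TREE by blast
    moreover from this have "E \<in> G T"
      using bfs_fixpoint_edges[OF T] card_tree_edges[OF T(1)] E by (simp add: G_def)
    ultimately show "E \<in> ?R" using T by blast
  next
    fix E assume "E \<in> ?R"
    then obtain T where T: "T \<in> placements k \<inter> TREE k" "E \<in> G T" by blast
    show "E \<in> ?L" using conn(1)[OF T] T card_tree_edges[of T k] by (auto simp: connected_on_def G_def)
  qed
  hence "num_connected_graphs k l = card (\<Union>T \<in> placements k \<inter> TREE k. G T)"
    by (simp add: num_connected_graphs_def)
  also have "\<dots> = (\<Sum>T \<in> placements k \<inter> TREE k. card (G T))"
  proof (rule card_UN_disjoint)
    show "\<forall>T\<in>placements k \<inter> TREE k. finite (G T)"
    proof
      fix T show "finite (G T)"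
        by (rule finite_subset[of _ "Pow (admissible_edges k T)"]) (use fin in \<open>auto simp: G_def\<close>)
    qed
    show "\<forall>T\<in>placements k \<inter> TREE k. \<forall>T'\<in>placements k \<inter> TREE k. T \<noteq> T' \<longrightarrow> G T \<inter> G T' = {}"
      using conn connected_on.bfs_fixpoint_unique by blast
  qed (use finite_placements in blast)
  also have "\<dots> = (\<Sum>T \<in> placements k \<inter> TREE k. nat (M k T) choose l)"
  proof (intro sum.cong refl)
    fix T assume T: "T \<in> placements k \<inter> TREE k"
    have "card (G T) = (card (admissible_edges k T) - card (tree_edges k T)) choose l"
      unfolding G_def using T by (intro card_sets_between fin tree_edges_admissible) auto
    also have "card (admissible_edges k T) - card (tree_edges k T) = nat (M k T)"
      using card_admissible_edges[of T k] card_tree_edges[of T k] T k by auto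
    finally show "card (G T) = nat (M k T) choose l" .
  qed
  finally show ?thesis .
qed

section \<open>Probabilities and the final identity\<close>

lemma set_placement_pmf_subset:
  assumes "k \<ge> 1" "0 < p" "p \<le> 1"
  shows "set_pmf (placement_pmf k p) \<subseteq> placements k"
proof -
  have "set_pmf (placement_pmf k p) \<subseteq> PiE_dflt {1..k-1} 0 (\<lambda>_. set_pmf (tilted_bin_pmf k p))"
    using set_Pi_pmf_subset'[of "{1..k-1}" 0] unfolding placement_pmf_def by (auto simp: o_def)
  thus ?thesis using set_tilted_bin_pmf(1)[OF assms] unfolding placements_def PiE_dflt_def by fastforce
qed

lemma pmf_placement_pmf:
  assumes "k \<ge> 1" "0 < p" "p \<le> 1" "T \<in> placements k"
  shows "pmf (placement_pmf k p) T =
    p ^ (k - 1) * (1 - p) ^ (\<Sum>j=1..k-1. T j - 1) / (1 - (1 - p) ^ k) ^ (k - 1)"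
proof -
  have "pmf (placement_pmf k p) T = (\<Prod>j=1..k-1. pmf (tilted_bin_pmf k p) (T j))"
    unfolding placement_pmf_def using placementsD(2)[OF assms(4)] by (intro pmf_Pi') auto
  also have "\<dots> = (\<Prod>j=1..k-1. p * (1 - p) ^ (T j - 1) / (1 - (1 - p) ^ k))"
    using placementsD(1)[OF assms(4)]
    by (intro prod.cong refl) (auto simp: pmf_tilted_bin_pmf[OF assms(1-3)] bin_weight_def)
  also have "\<dots> = p ^ (k - 1) * (1 - p) ^ (\<Sum>j=1..k-1. T j - 1) / (1 - (1 - p) ^ k) ^ (k - 1)"
    by (simp add: prod_dividef prod.distrib power_sum)
  finally show ?thesis .
qed

text \<open>The factor for \<open>TREE\<close> cancels the normalisation of the conditional
  distribution.\<close>

lemma prob_TREE_mult_pmf_Bin_Mstar: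
  assumes "k \<ge> 1" "0 < p" "p \<le> 1"
  shows "measure_pmf.prob (placement_pmf k p) (TREE k) * pmf (Bin_Mstar_pmf k p) l =
    (\<Sum>T \<in> placements k \<inter> TREE k. pmf (placement_pmf k p) T * pmf (binomial_pmf (nat (M k T)) p) l)"
proof -
  let ?P = "measure_pmf.prob (placement_pmf k p) (TREE k)"
  note ne = TREE_possible[OF assms]
  have pos: "?P \<noteq> 0" using ne by (auto simp: measure_pmf_zero_iff)
  have "Bin_Mstar_pmf k p =
      bind_pmf (cond_pmf (placement_pmf k p) (TREE k)) (\<lambda>T. binomial_pmf (nat (M k T)) p)"
    by (simp add: Bin_Mstar_pmf_def Mstar_pmf_def bind_map_pmf)
  hence "pmf (Bin_Mstar_pmf k p) l =
      (\<integral>T. pmf (binomial_pmf (nat (M k T)) p) l \<partial>cond_pmf (placement_pmf k p) (TREE k))"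
    by (simp add: pmf_bind)
  \<comment> \<open>The index set contains the support but can be larger: for \<open>p = 1\<close>
    all balls fall into bin 1 almost surely.\<close>
  also have "\<dots> = (\<Sum>T \<in> placements k \<inter> TREE k.
      pmf (binomial_pmf (nat (M k T)) p) l * pmf (cond_pmf (placement_pmf k p) (TREE k)) T)"
    using finite_placements set_placement_pmf_subset[OF assms] ne
    by (intro integral_measure_pmf_real) (auto simp: set_cond_pmf)
  also have "?P * \<dots> = (\<Sum>T \<in> placements k \<inter> TREE k.
      pmf (placement_pmf k p) T * pmf (binomial_pmf (nat (M k T)) p) l)"
    unfolding sum_distrib_left using pos by (intro sum.cong refl) (auto simp: pmf_cond[OF ne])
  finally show ?thesis by simp
qed

text \<open>All pairs of vertices split into \<open>k - 1\<close> tree edges, \<open>M k T\<close>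
  optional edges and, for each ball \<open>j\<close>, the \<open>T j - 1\<close> forbidden edges to
  vertices visited before its parent.\<close>

lemma TREE_sum_minus_one:
  assumes T: "T \<in> placements k" "T \<in> TREE k" and k: "k \<ge> 1"
  shows "int (\<Sum>j=1..k-1. T j - 1) + M k T = int (k choose 2) - int (k - 1)" "M k T \<ge> 0"
proof -
  have "int (\<Sum>j=1..k-1. T j - 1) = (\<Sum>j=1..k-1. int (T j) - 1)"
    unfolding of_nat_sum using placementsD(1)[OF T(1)] by (intro sum.cong refl) force
  thus "int (\<Sum>j=1..k-1. T j - 1) + M k T = int (k choose 2) - int (k - 1)"
    by (simp add: sum_subtractf M_def)
  have "card (tree_edges k T) \<le> card (admissible_edges k T)"
    by (intro card_mono tree_edges_admissible T finite_subset[OF admissible_edges_subset])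
      (auto intro: finite_subset[of _ "Pow {1..k}"])
  thus "M k T \<ge> 0" using card_tree_edges[OF T] card_admissible_edges[OF T k] by simp
qed

theorem theorem1:
  fixes k l :: nat and p :: real
  assumes "k \<ge> 2" and "0 < p" and "p \<le> 1"
  defines "A1 \<equiv> (1 - (1 - p) ^ k) ^ (k - 1)"
    and "A2 \<equiv> measure_pmf.prob (placement_pmf k p) (TREE k)"
    and "A3 \<equiv> pmf (Bin_Mstar_pmf k p) l"
  shows "A1 * A2 * A3 =
    real (num_connected_graphs k l) * p ^ (k + l - 1) *
      (1 - p) powi (int (k choose 2) - int (k + l - 1))"
proof -
  have k: "k \<ge> 1" using assms(1) by simp
  have "(1 - p) ^ k < 1"
    using assms(1-3) by (intro power_less_one_iff[THEN iffD2]) auto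
  hence A1: "A1 \<noteq> 0" by (simp add: A1_def)
  let ?q = "p ^ (k + l - 1) * (1 - p) powi (int (k choose 2) - int (k + l - 1))"
  have "A1 * (pmf (placement_pmf k p) T * pmf (binomial_pmf (nat (M k T)) p) l)
      = real (nat (M k T) choose l) * ?q" if T: "T \<in> placements k" "T \<in> TREE k" for T
  proof (cases "l \<le> nat (M k T)")
    case True
    let ?s = "\<Sum>j=1..k-1. T j - 1"
    \<comment> \<open>Both sides count the absent edges: those forbidden by \<open>T\<close> and the
      optional ones not chosen. The exponent is therefore a natural number.\<close>
    have "int (?s + (nat (M k T) - l)) = int (k choose 2) - int (k + l - 1)"
      using TREE_sum_minus_one[OF T k] True k by simp
    hence pw: "(1 - p) powi (int (k choose 2) - int (k + l - 1)) = (1 - p) ^ (?s + (nat (M k T) - l))"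
      by (metis power_int_of_nat)
    have "k + l - 1 = (k - 1) + l" using k by simp
    moreover have "A1 * pmf (placement_pmf k p) T = p ^ (k - 1) * (1 - p) ^ ?s"
      using pmf_placement_pmf[OF k assms(2,3) T(1)] A1 by (simp add: A1_def)
    moreover have "pmf (binomial_pmf (nat (M k T)) p) l =
        real (nat (M k T) choose l) * p ^ l * (1 - p) ^ (nat (M k T) - l)"
      using assms(2,3) by simp
    ultimately show ?thesis
      unfolding pw mult.assoc[symmetric] by (simp add: power_add)
  next
    case False
    \<comment> \<open>The exponent of \<open>powi\<close> may be negative here, but both sides are
      0.\<close>
    thus ?thesis using assms(2,3) by (simp add: binomial_eq_0)
  qed
  hence "A1 * (A2 * A3) = (\<Sum>T \<in> placements k \<inter> TREE k. real (nat (M k T) choose l) * ?q)"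
    unfolding A2_def A3_def prob_TREE_mult_pmf_Bin_Mstar[OF k assms(2,3)] sum_distrib_left
    by (intro sum.cong refl) auto
  also have "\<dots> = real (num_connected_graphs k l) * ?q"
    by (simp add: num_connected_graphs_eq_sum[OF k] sum_distrib_right)
  finally show ?thesis by (simp add: mult.assoc)
qed

end
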